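(* Let $\mathbb F=\mathbb R$ or $\mathbb F=\mathbb C$ and $n\ge 1$. For every partition $n=m_1+m_2+\cdots+m_r$ of $n$ into positive integers, there is an irreducible tridiagonal $n\times n$ matrix over $\mathbb F$ whose list of algebraic multiplicities of its distinct eigenvalues is $m_1,m_2,\dots,m_r$.
   Context: A (normalized) tridiagonal matrix over $\mathbb F$ is an $n\times n$ matrix $A$ with diagonal entries $a_1,\dots,a_n\in\mathbb F$, all superdiagonal entries (positions $(i,i+1)$) equal to $1$, subdiagonal entries (positions $(i+1,i)$) $b_1,\dots,b_{n-1}\in\mathbb F$, and all other entries $0$. It is irreducible if $b_i\neq 0$ for all $i=1,\dots,n-1$. *)

theory Defs
  imports Complex_Main "Jordan_Normal_Form.Char_Poly"
begin

text \<open>Rows and columns are indexed from 0, so \<open>a 0, \<dots>, a (n - 1)\<close> is the diagonal and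
  \<open>b i\<close>, at position \<open>(i + 1, i)\<close> for \<open>i + 1 < n\<close>, is the subdiagonal.\<close>

definition tridiag_mat :: "nat \<Rightarrow> (nat \<Rightarrow> 'a) \<Rightarrow> (nat \<Rightarrow> 'a) \<Rightarrow> 'a :: zero_neq_one mat" where
  "tridiag_mat n a b = mat n n (\<lambda>(i, j).
     if i = j then a i else if j = i + 1 then 1 else if i = j + 1 then b j else 0)"

definition irreducible_tridiagonal :: "nat \<Rightarrow> 'a :: zero_neq_one mat \<Rightarrow> bool" where
  "irreducible_tridiagonal n A \<longleftrightarrow>
     (\<exists>a b. A = tridiag_mat n a b \<and> (\<forall>i. i + 1 < n \<longrightarrow> b i \<noteq> 0))"

definition alg_mult :: "'a :: field mat \<Rightarrow> 'a \<Rightarrow> nat" where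
  "alg_mult A k = order k (char_poly A)"

text \<open>Eigenvalues are taken in the base field \<open>'a\<close>. In particular, a real \<open>n \<times> n\<close> matrix whose
  list of multiplicities sums to \<open>n\<close> has only real eigenvalues.\<close>

definition has_multiplicity_list :: "'a :: field mat \<Rightarrow> nat list \<Rightarrow> bool" where
  "has_multiplicity_list A ms \<longleftrightarrow>
     (\<exists>es. distinct es \<and> set es = {k. eigenvalue A k} \<and> map (alg_mult A) es = ms)"

end

theory Submission
  imports Defs
begin

text \<open>
  The characteristic polynomials \<open>P\<^sub>k\<close> of the leading principal \<open>k \<times> k\<close> blocks of a tridiagonal
  matrix satisfy \<open>P\<^sub>k\<^sub>+\<^sub>2 = (x - a\<^sub>k\<^sub>+\<^sub>1) P\<^sub>k\<^sub>+\<^sub>1 - b\<^sub>k P\<^sub>k\<close>. So a monic \<open>p\<close> is the characteristic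
  polynomial of an irreducible tridiagonal matrix as soon as there is a monic \<open>q\<close> of degree one
  less such that the Euclidean algorithm on \<open>(p, q)\<close> lowers the degree by exactly one in every
  step: the quotients give the diagonal and the normalization of the remainders gives the nonzero
  subdiagonal. Such a pair is called a Jacobi pair below. It suffices to find a partner \<open>q\<close> for
  every product \<open>p\<close> of linear factors, repeated or not.

  This goes by induction on the number of factors. Let \<open>(p, q)\<close> be a Jacobi pair. The
  Euclidean algorithm on \<open>((x - l) p, (x - l) q)\<close> has the same quotients, and it stops one step
  too early, at the greatest common divisor \<open>x - l\<close>. Replace the second polynomial by
  \<open>(x - l) q + c\<close> with a small \<open>c \<noteq> 0\<close>. The coefficients that must not vanish in the
  existing steps depend continuously on \<open>c\<close>, so they remain nonzero, and a linear polynomial near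
  \<open>x - l\<close> is reached. The one remaining step succeeds if that linear polynomial does not divide the
  starting pair, hence if the two starting polynomials have no common zero. At a zero \<open>y\<close> of
  \<open>(x - l) p\<close> the second polynomial takes the value \<open>(y - l) q(y) + c\<close>, so only finitely many
  values of \<open>c\<close> are bad. The continuity argument is \<open>jacobi_pair_perturb\<close>, the induction is
  \<open>split_poly_jacobi_pair\<close>, and \<open>jacobi_pair_tridiag_mat\<close> turns the pair into a matrix. All of
  this works over any normed field that contains the reals; distinct natural numbers then serve as
  the eigenvalues.
\<close>

section \<open>Euclidean algorithms with all degree drops equal to one\<close>

text \<open>The index is the degree of the second polynomial, not the size of the matrix. The rule \<open>step\<close>
  undoes one division with quotient \<open>x - a\<close>, remainder \<open>- b r\<close> and monic \<open>r\<close>.\<close>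

inductive jacobi_pair :: "nat \<Rightarrow> 'a :: field poly \<Rightarrow> 'a poly \<Rightarrow> bool" where
  linear: "jacobi_pair 0 [:- a, 1:] 1"
| step: "jacobi_pair n q r \<Longrightarrow> b \<noteq> 0 \<Longrightarrow>
    jacobi_pair (Suc n) ([:- a, 1:] * q - Polynomial.smult b r) q"

definition monic_of_degree :: "nat \<Rightarrow> 'a :: field poly \<Rightarrow> bool" where
  "monic_of_degree n p \<longleftrightarrow> degree p \<le> n \<and> coeff p n = 1"

lemma coeff_linear_mult:
  fixes p :: "'a :: comm_ring_1 poly"
  shows "coeff ([:- a, 1:] * p) i = (case i of 0 \<Rightarrow> 0 | Suc j \<Rightarrow> coeff p j) - a * coeff p i"
  by (simp add: coeff_pCons split: nat.split)

lemma monic_of_degree_linear_mult: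
  assumes "monic_of_degree n p"
  shows "monic_of_degree (Suc n) ([:- a, 1:] * p)"
proof -
  have "degree ([:- a, 1:] * p) \<le> degree [:- a, 1:] + degree p"
    by (rule degree_mult_le)
  then show ?thesis
    using assms unfolding monic_of_degree_def coeff_linear_mult
    by (simp add: coeff_eq_0)
qed

lemma monic_of_degree_minus:
  assumes "monic_of_degree (Suc n) p" "degree q \<le> n"
  shows "monic_of_degree (Suc n) (p - q)"
  using assms unfolding monic_of_degree_def
  by (auto intro!: degree_diff_le simp: coeff_eq_0)

lemma jacobi_pair_monic:
  "jacobi_pair n p q \<Longrightarrow> monic_of_degree (Suc n) p \<and> monic_of_degree n q"
proof (induction rule: jacobi_pair.induct)
  case (linear a)
  show ?case by (simp add: monic_of_degree_def)
next
  case (step n q r b a)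
  have "degree (Polynomial.smult b r) \<le> Suc n"
    using step.IH unfolding monic_of_degree_def by (simp add: le_Suc_eq)
  then show ?case
    using step.IH by (intro conjI monic_of_degree_minus monic_of_degree_linear_mult) auto
qed

text \<open>The quotient of two monic polynomials of consecutive degrees is \<open>x - d\<close>, where \<open>d\<close> is the
  value that cancels the second highest coefficient. As this \<open>d\<close> is polynomial in the
  coefficients, the remainder depends continuously on them.\<close>

lemma division_step_degree:
  assumes "monic_of_degree (Suc (Suc n)) p" "monic_of_degree (Suc n) q"
  shows "degree ([:- (coeff q n - coeff p (Suc n)), 1:] * q - p) \<le> n"
proof (rule degree_le, intro allI impI)
  fix i assume "n < i"
  then consider "i = Suc n" | "i = Suc (Suc n)" | j where "i = Suc j" "j > Suc n"
    by (metis Suc_lessI Suc_lessE)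
  then show "coeff ([:- (coeff q n - coeff p (Suc n)), 1:] * q - p) i = 0"
    using assms unfolding monic_of_degree_def coeff_diff coeff_linear_mult
    by cases (auto simp: coeff_eq_0)
qed

section \<open>Perturbing away a common linear factor\<close>

text \<open>
  For \<open>f\<close> and \<open>g\<close> near \<open>(x - l) p\<close> and \<open>(x - l) q\<close>, the division steps of \<open>(p, q)\<close> carry over
  by continuity, because a leading coefficient near a nonzero \<open>b\<close> is nonzero. The induction
  follows these steps and ends at monic polynomials of degrees two and one, where the constant
  remainder has limit zero. There continuity says nothing, and the absence of common zeros
  takes its place: it passes from \<open>(f, g)\<close> to \<open>g\<close> and the remainder, since a common zero of the
  latter two is a zero of \<open>f\<close>.
\<close>

lemma jacobi_pair_perturb:
  fixes f g :: "'b \<Rightarrow> 'a :: real_normed_field poly"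
  assumes "jacobi_pair n p q"
    and "\<forall>\<^sub>F c in F. monic_of_degree (Suc (Suc n)) (f c)"
    and "\<forall>\<^sub>F c in F. monic_of_degree (Suc n) (g c)"
    and "\<And>i. ((\<lambda>c. coeff (f c) i) \<longlongrightarrow> coeff ([:- l, 1:] * p) i) F"
    and "\<And>i. ((\<lambda>c. coeff (g c) i) \<longlongrightarrow> coeff ([:- l, 1:] * q) i) F"
    and "\<forall>\<^sub>F c in F. \<forall>x. poly (f c) x = 0 \<longrightarrow> poly (g c) x \<noteq> 0"
  shows "\<forall>\<^sub>F c in F. jacobi_pair (Suc n) (f c) (g c)"
  using assms
proof (induction arbitrary: f g rule: jacobi_pair.induct)
  case (linear a)
  show ?case
    using linear.prems(1,2,5)
  proof eventually_elim
    case (elim c)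
    define d where "d = coeff (g c) 0 - coeff (f c) (Suc 0)"
    define e where "e = - coeff (g c) 0"
    have g: "g c = [:- e, 1:]"
    proof (rule poly_eqI)
      fix i
      show "coeff (g c) i = coeff [:- e, 1:] i"
        using elim(2) unfolding monic_of_degree_def e_def
        by (auto simp: coeff_pCons coeff_eq_0 split: nat.split)
    qed
    obtain b where b: "[:- d, 1:] * g c - f c = [:b:]"
      using division_step_degree[OF elim(1,2)] unfolding d_def
      by (metis degree_eq_zeroE le_zero_eq)
    have f: "f c = [:- d, 1:] * g c - Polynomial.smult b 1"
      using b by (simp add: algebra_simps one_pCons)
    \<comment> \<open>if the division left no remainder, the zero of the linear divisor would be shared\<close>
    have "b \<noteq> 0"
    proof
      assume "b = 0"
      then have "poly (f c) e = 0" "poly (g c) e = 0"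
        using f g by simp_all
      then show False using elim(3) by blast
    qed
    then have "jacobi_pair (Suc 0) ([:- d, 1:] * [:- e, 1:] - Polynomial.smult b 1) [:- e, 1:]"
      by (intro jacobi_pair.intros)
    then show ?case using f g by simp
  qed
next
  case (step n q r b a)
  let ?l = "[:- l, 1:]"
  \<comment> \<open>one division step, done for all parameters at once: quotient \<open>x - d c\<close>, negated remainder
      \<open>h c\<close> and its normalization \<open>s c\<close>\<close>
  define d where "d = (\<lambda>c. coeff (g c) (Suc n) - coeff (f c) (Suc (Suc n)))"
  define h where "h = (\<lambda>c. [:- d c, 1:] * g c - f c)"
  define \<beta> where "\<beta> = (\<lambda>c. coeff (h c) (Suc n))"
  define s where "s = (\<lambda>c. Polynomial.smult (1 / \<beta> c) (h c))"
  have mr: "monic_of_degree (Suc n) (?l * r)" and mq: "monic_of_degree (Suc (Suc n)) (?l * q)"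
    using jacobi_pair_monic[OF step.hyps(1)] monic_of_degree_linear_mult by blast+
  have F_eq: "?l * ([:- a, 1:] * q - Polynomial.smult b r) =
      [:- a, 1:] * (?l * q) - Polynomial.smult b (?l * r)"
    by (simp only: right_diff_distrib mult_smult_right mult.left_commute)
  have "coeff (?l * q) (Suc n) - coeff (?l * ([:- a, 1:] * q - Polynomial.smult b r)) (Suc (Suc n)) = a"
    unfolding F_eq coeff_diff coeff_smult coeff_linear_mult[of a "?l * q"]
    using mr mq unfolding monic_of_degree_def by (simp add: coeff_eq_0 del: mult_pCons_left)
  then have d_lim: "(d \<longlongrightarrow> a) F"
    unfolding d_def
    using tendsto_diff[OF step.prems(4)[of "Suc n"] step.prems(3)[of "Suc (Suc n)"]] by simp
  have h_lim: "((\<lambda>c. coeff (h c) i) \<longlongrightarrow> b * coeff (?l * r) i) F" for i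
  proof -
    have "((\<lambda>c. (case i of 0 \<Rightarrow> 0 | Suc j \<Rightarrow> coeff (g c) j) - d c * coeff (g c) i - coeff (f c) i)
        \<longlongrightarrow> (case i of 0 \<Rightarrow> 0 | Suc j \<Rightarrow> coeff (?l * q) j) - a * coeff (?l * q) i
          - coeff (?l * ([:- a, 1:] * q - Polynomial.smult b r)) i) F"
      using step.prems(3,4) d_lim by (cases i) (auto intro!: tendsto_intros simp del: mult_pCons_left)
    moreover have "(case i of 0 \<Rightarrow> 0 | Suc j \<Rightarrow> coeff (?l * q) j) - a * coeff (?l * q) i
          - coeff (?l * ([:- a, 1:] * q - Polynomial.smult b r)) i = b * coeff (?l * r) i"
      unfolding F_eq coeff_diff coeff_smult coeff_linear_mult[of a "?l * q"] by simp
    ultimately show ?thesis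
      unfolding h_def coeff_diff coeff_linear_mult by simp
  qed
  have \<beta>_lim: "(\<beta> \<longlongrightarrow> b) F"
    using h_lim[of "Suc n"] mr unfolding \<beta>_def monic_of_degree_def by simp
  have \<beta>_nz: "\<forall>\<^sub>F c in F. \<beta> c \<noteq> 0"
    using tendsto_imp_eventually_ne[OF \<beta>_lim step.hyps(2)] .
  have f_eq: "f c = [:- d c, 1:] * g c - Polynomial.smult (\<beta> c) (s c)" if "\<beta> c \<noteq> 0" for c
    using that unfolding s_def h_def by simp
  have "\<forall>\<^sub>F c in F. jacobi_pair (Suc n) (g c) (s c)"
  proof (rule step.IH)
    show "\<forall>\<^sub>F c in F. monic_of_degree (Suc n) (s c)"
      using step.prems(1,2) \<beta>_nz
    proof eventually_elim
      case (elim c)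
      then show ?case
        using division_step_degree[OF elim(1,2)]
        unfolding monic_of_degree_def s_def h_def d_def \<beta>_def by simp
    qed
    show "((\<lambda>c. coeff (s c) i) \<longlongrightarrow> coeff (?l * r) i) F" for i
    proof -
      have "((\<lambda>c. 1 / \<beta> c * coeff (h c) i) \<longlongrightarrow> 1 / b * (b * coeff (?l * r) i)) F"
        using \<beta>_lim h_lim step.hyps(2) by (intro tendsto_intros)
      then show ?thesis unfolding s_def using step.hyps(2) by simp
    qed
    show "\<forall>\<^sub>F c in F. \<forall>x. poly (g c) x = 0 \<longrightarrow> poly (s c) x \<noteq> 0"
      using step.prems(5) \<beta>_nz
    proof eventually_elim
      case (elim c)
      show ?case
        using elim(1) f_eq[OF elim(2)]
        by (metis poly_diff poly_mult poly_smult mult_zero_right diff_zero)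
    qed
  qed (use step.prems in auto)
  with \<beta>_nz show ?case
  proof eventually_elim
    case (elim c)
    show ?case
      using jacobi_pair.step[OF elim(2,1)] f_eq[OF elim(1)] by metis
  qed
qed

lemma prod_linear_nonzero:
  fixes xs :: "'a :: field list"
  shows "(\<Prod>x\<leftarrow>xs. [:- x, 1:]) \<noteq> 0"
  by (auto simp: prod_list_zero_iff)

text \<open>At least one linear factor is needed, whence the separate \<open>l\<close>. In the induction step only the
  second polynomial is perturbed, so the first one keeps its prescribed roots.\<close>

lemma split_poly_jacobi_pair:
  fixes xs :: "'a :: real_normed_field list"
  shows "\<exists>q. jacobi_pair (length xs) (\<Prod>x\<leftarrow>l # xs. [:- x, 1:]) q"
proof (induction xs arbitrary: l)
  case Nil
  show ?case using jacobi_pair.linear[of l] by auto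
next
  case (Cons y xs)
  let ?p = "\<Prod>x\<leftarrow>y # xs. [:- x, 1:]" and ?l = "[:- l, 1:]"
  obtain q where q: "jacobi_pair (length xs) ?p q"
    using Cons.IH by blast
  let ?n = "length xs"
  define g where "g = (\<lambda>c. ?l * q + [:c:])"
  have monic: "monic_of_degree (Suc ?n) ?p" "monic_of_degree ?n q"
    using jacobi_pair_monic[OF q] by auto
  have fin: "finite {x. poly (?l * ?p) x = 0}"
    using poly_roots_finite[OF prod_linear_nonzero[of "l # y # xs"]] by simp
  have "\<forall>\<^sub>F c in at 0. jacobi_pair (Suc ?n) (?l * ?p) (g c)"
  proof (rule jacobi_pair_perturb[OF q, where l = l])
    show "\<forall>\<^sub>F c in at 0. monic_of_degree (Suc (Suc ?n)) (?l * ?p)"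
      using monic_of_degree_linear_mult[OF monic(1)] by (intro always_eventually) blast
    have "g c = ?l * q - [:- c:]" for c
      unfolding g_def by simp
    then show "\<forall>\<^sub>F c in at 0. monic_of_degree (Suc ?n) (g c)"
      using monic_of_degree_minus[OF monic_of_degree_linear_mult[OF monic(2)], of "[:- _:]"]
      by (intro always_eventually) simp
    show "((\<lambda>c. coeff (g c) i) \<longlongrightarrow> coeff (?l * q) i) (at 0)" for i
    proof -
      have "((\<lambda>c. coeff (?l * q) i + (if i = 0 then c else 0)) \<longlongrightarrow> coeff (?l * q) i + 0) (at 0)"
        by (cases "i = 0") (auto intro!: tendsto_eq_intros simp del: mult_pCons_left)
      moreover have "coeff [:c:] i = (if i = 0 then c else 0)" for c :: 'a
        by (simp add: coeff_pCons split: nat.split)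
      ultimately show ?thesis
        unfolding g_def coeff_add by simp
    qed
    \<comment> \<open>each zero of the first polynomial excludes a single value of \<open>c\<close>; when it is a zero of
        \<open>(x - l) q\<close> the excluded value is 0 itself, hence the punctured filter\<close>
    have "\<forall>\<^sub>F c in at 0. \<forall>x\<in>{x. poly (?l * ?p) x = 0}. c \<noteq> - poly (?l * q) x"
      using fin by (intro eventually_ball_finite ballI eventually_neq_at_within)
    then show "\<forall>\<^sub>F c in at 0. \<forall>x. poly (?l * ?p) x = 0 \<longrightarrow> poly (g c) x \<noteq> 0"
      by (rule eventually_mono) (auto simp: g_def add_eq_0_iff simp del: mult_pCons_left)
  qed simp
  then obtain c where "jacobi_pair (Suc ?n) (?l * ?p) (g c)"
    using eventually_happens'[OF at_neq_bot] by blast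
  then have "jacobi_pair (length (y # xs)) (\<Prod>x\<leftarrow>l # y # xs. [:- x, 1:]) (g c)"
    by (simp only: list.size list.map prod_list.Cons add_Suc_right add_0_right)
  then show ?case by blast
qed

section \<open>Jacobi pairs as characteristic polynomials\<close>

lemma tridiag_mat_carrier [simp]: "tridiag_mat n a b \<in> carrier_mat n n"
  by (simp add: tridiag_mat_def)

lemma tridiag_mat_cong:
  assumes "\<And>i. i < n \<Longrightarrow> a i = a' i" "\<And>i. Suc i < n \<Longrightarrow> b i = b' i"
  shows "tridiag_mat n a b = tridiag_mat n a' b'"
  using assms by (intro eq_matI) (auto simp: tridiag_mat_def)

lemma char_poly_tridiag_mat_0: "char_poly (tridiag_mat 0 a b) = 1"
  by (simp add: char_poly_def char_poly_matrix_def tridiag_mat_def det_dim_zero)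

lemma char_poly_tridiag_mat_1: "char_poly (tridiag_mat (Suc 0) a b) = [:- a 0, 1:]"
  by (simp add: char_poly_def char_poly_matrix_def tridiag_mat_def det_single)

text \<open>Expansion along the last row, which has two nonzero entries. The minor \<open>B\<close> of the off-diagonal one
  has a last column whose only nonzero entry is the superdiagonal \<open>- 1\<close>, so expanding it along that
  column leaves the block two sizes smaller.\<close>

lemma char_poly_tridiag_mat_rec:
  fixes a b :: "nat \<Rightarrow> 'a :: field"
  shows "char_poly (tridiag_mat (Suc (Suc n)) a b) =
    [:- a (Suc n), 1:] * char_poly (tridiag_mat (Suc n) a b)
      - Polynomial.smult (b n) (char_poly (tridiag_mat n a b))"
proof -
  define M where "M = (\<lambda>n. char_poly_matrix (tridiag_mat n a b))"
  have M: "M k \<in> carrier_mat k k" for k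
    unfolding M_def by simp
  have M_entry: "M k $$ (i, j) = (if i = j then [:- a i, 1:] else if j = Suc i then [:- 1:]
      else if i = Suc j then [:- b j:] else 0)" if "i < k" "j < k" for i j k
    using that by (auto simp: M_def char_poly_matrix_def tridiag_mat_def)
  define B where "B = mat_delete (M (Suc (Suc n))) (Suc n) n"
  have B: "B \<in> carrier_mat (Suc n) (Suc n)"
    unfolding B_def using mat_delete_carrier[OF M[of "Suc (Suc n)"]] by simp
  have B_entry: "B $$ (i, n) = (if i = n then - 1 else 0)" if "i < Suc n" for i
    using that M[of "Suc (Suc n)"]
    by (auto simp: B_def mat_delete_def M_entry one_pCons)
  have del_B: "mat_delete B n n = M n"
    by (rule eq_matI) (use M[of n] M[of "Suc (Suc n)"] in \<open>auto simp: B_def mat_delete_def M_entry\<close>)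
  have del_M: "mat_delete (M (Suc (Suc n))) (Suc n) (Suc n) = M (Suc n)"
    by (rule eq_matI)
      (use M[of "Suc n"] M[of "Suc (Suc n)"] in \<open>auto simp: mat_delete_def M_entry\<close>)
  have "det B = (\<Sum>i<Suc n. B $$ (i, n) * cofactor B i n)"
    using laplace_expansion_column[OF B, of n] by simp
  also have "\<dots> = - det (M n)"
    by (simp add: B_entry cofactor_def del_B flip: mult_2 power_mult_distrib)
  finally have det_B: "det B = - det (M n)" .
  have "det (M (Suc (Suc n))) =
      (\<Sum>j<Suc (Suc n). M (Suc (Suc n)) $$ (Suc n, j) * cofactor (M (Suc (Suc n))) (Suc n) j)"
    using laplace_expansion_row[OF M[of "Suc (Suc n)"], of "Suc n"] by simp
  also have "\<dots> = [:- b n:] * cofactor (M (Suc (Suc n))) (Suc n) n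
      + [:- a (Suc n), 1:] * cofactor (M (Suc (Suc n))) (Suc n) (Suc n)"
    by (simp add: M_entry del: mult_pCons_left)
  also have "cofactor (M (Suc (Suc n))) (Suc n) n = det (M n)"
    by (simp add: cofactor_def det_B flip: B_def)
  also have "cofactor (M (Suc (Suc n))) (Suc n) (Suc n) = det (M (Suc n))"
    by (simp add: cofactor_def del_M)
  finally show ?thesis
    by (simp add: char_poly_def M_def)
qed

text \<open>Each division step appends one row and column. The smaller blocks are untouched, because a
  block of size \<open>k\<close> reads only \<open>a i\<close> for \<open>i < k\<close> and \<open>b i\<close> for \<open>i + 1 < k\<close>.\<close>

lemma jacobi_pair_tridiag_mat:
  "jacobi_pair n p q \<Longrightarrow>
    \<exists>a b. (\<forall>i<n. b i \<noteq> 0) \<and> char_poly (tridiag_mat (Suc n) a b) = p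
      \<and> char_poly (tridiag_mat n a b) = q"
proof (induction rule: jacobi_pair.induct)
  case (linear a)
  show ?case
    by (rule exI[of _ "\<lambda>_. a"]) (simp add: char_poly_tridiag_mat_0 char_poly_tridiag_mat_1)
next
  case (step n q r \<beta> \<alpha>)
  then obtain a b where ab: "\<forall>i<n. b i \<noteq> 0" "char_poly (tridiag_mat (Suc n) a b) = q"
    "char_poly (tridiag_mat n a b) = r"
    by blast
  let ?a = "a(Suc n := \<alpha>)" and ?b = "b(n := \<beta>)"
  have "tridiag_mat (Suc n) ?a ?b = tridiag_mat (Suc n) a b"
    "tridiag_mat n ?a ?b = tridiag_mat n a b"
    by (auto intro: tridiag_mat_cong)
  then have "char_poly (tridiag_mat (Suc n) ?a ?b) = q"
    "char_poly (tridiag_mat (Suc (Suc n)) ?a ?b) = [:- \<alpha>, 1:] * q - Polynomial.smult \<beta> r"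
    using ab by (simp_all add: char_poly_tridiag_mat_rec del: mult_pCons_left)
  moreover have "\<forall>i<Suc n. ?b i \<noteq> 0"
    using ab(1) step.hyps(2) by (simp add: less_Suc_eq)
  ultimately show ?case by blast
qed

section \<open>Prescribing the multiplicities\<close>

lemma order_prod_linear:
  fixes xs :: "'a :: field list"
  shows "order x (\<Prod>y\<leftarrow>xs. [:- y, 1:]) = count_list xs x"
proof (induction xs)
  case Nil
  show ?case by simp
next
  case (Cons y xs)
  have nz: "[:- y, 1:] * (\<Prod>y\<leftarrow>xs. [:- y, 1:]) \<noteq> 0"
    using prod_linear_nonzero[of "y # xs"] by simp
  have "order x [:- y, 1:] = (if x = y then 1 else 0)"
    using order_power_n_n[of y 1] by (auto simp: order_0I)
  then show ?case
    using order_mult[of "[:- y, 1:]" "\<Prod>y\<leftarrow>xs. [:- y, 1:]" x] nz Cons.IH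
    by (auto simp del: mult_pCons_left)
qed

lemma count_list_replicate: "count_list (replicate m y) x = (if x = y then m else 0)"
  by (induction m) auto

lemma count_list_concat: "count_list (concat xss) x = (\<Sum>xs\<leftarrow>xss. count_list xs x)"
  by (induction xss) auto

text \<open>The \<open>i\<close>-th eigenvalue is the natural number \<open>i\<close>, occurring \<open>ms ! i\<close> times in the list \<open>xs\<close> of
  roots. Since all parts are positive, no index is lost and the eigenvalues are in bijection
  with the parts.\<close>

lemma exists_tridiagonal_with_multiplicities:
  assumes "ms \<noteq> []" "\<forall>m\<in>set ms. m \<ge> 1"
  shows "\<exists>A :: 'a :: real_normed_field mat.
    irreducible_tridiagonal (sum_list ms) A \<and> has_multiplicity_list A ms"
proof -
  define N where "N = length ms"
  define e where "e = (of_nat :: nat \<Rightarrow> 'a)"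
  define xs where "xs = concat (map (\<lambda>i. replicate (ms ! i) (e i)) [0..<N])"
  have e_inj: "inj e" unfolding e_def by (simp add: inj_on_def)
  have len: "length xs = sum_list ms"
    by (simp add: xs_def N_def length_concat comp_def map_nth)
  have count: "count_list xs x = (\<Sum>i<N. if x = e i then ms ! i else 0)" for x
    by (simp add: xs_def count_list_concat count_list_replicate comp_def
        interv_sum_list_conv_sum_set_nat atLeast0LessThan)
  have count_e: "count_list xs (e j) = ms ! j" if "j < N" for j
    using that by (simp add: count inj_eq[OF e_inj])
  have "ms ! i \<noteq> 0" if "i < N" for i
    using assms(2) nth_mem[of i ms] that unfolding N_def by (metis not_one_le_zero)
  then have "set xs = (\<Union>i<N. {e i})"
    unfolding xs_def by (simp add: atLeast0LessThan)
  then have set_xs: "set xs = e ` {..<N}" by blast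
  have "set xs \<noteq> {}" using assms(1) set_xs by (auto simp: N_def)
  then obtain l ys where xs_eq: "xs = l # ys" by (cases xs) auto
  obtain a b where b: "\<forall>i<length ys. b i \<noteq> 0"
    and char: "char_poly (tridiag_mat (Suc (length ys)) a b) = (\<Prod>x\<leftarrow>xs. [:- x, 1:])"
    using split_poly_jacobi_pair[of ys l] jacobi_pair_tridiag_mat unfolding xs_eq by blast
  define A where "A = tridiag_mat (Suc (length ys)) a b"
  have mult: "alg_mult A k = count_list xs k" for k
    unfolding alg_mult_def A_def char order_prod_linear ..
  have A: "A \<in> carrier_mat (Suc (length ys)) (Suc (length ys))"
    unfolding A_def by simp
  have "order k (char_poly A) \<noteq> 0 \<longleftrightarrow> k \<in> set xs" for k
    using mult[of k] unfolding alg_mult_def by (simp add: count_list_0_iff)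
  then have eigen: "{k. eigenvalue A k} = e ` {..<N}"
    using prod_linear_nonzero[of xs]
    unfolding eigenvalue_root_char_poly[OF A] order_root set_xs[symmetric]
    by (simp add: A_def char)
  have "map (alg_mult A) (map e [0..<N]) = ms"
    by (rule nth_equalityI) (simp_all add: mult count_e N_def)
  moreover have "distinct (map e [0..<N])"
    by (simp add: distinct_map inj_on_subset[OF e_inj])
  moreover have "set (map e [0..<N]) = {k. eigenvalue A k}"
    unfolding eigen by (simp add: atLeast0LessThan)
  ultimately have "has_multiplicity_list A ms"
    unfolding has_multiplicity_list_def by blast
  moreover have "irreducible_tridiagonal (sum_list ms) A"
    unfolding irreducible_tridiagonal_def A_def len[symmetric] xs_eq
    by (intro exI[of _ a] exI[of _ b]) (use b in simp)
  ultimately show ?thesis by blast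
qed

theorem corollary4:
  fixes n :: nat and ms :: "nat list"
  assumes "n \<ge> 1"
    and "\<forall>m \<in> set ms. m \<ge> 1"
    and "sum_list ms = n"
  shows "(\<exists>A :: real mat. irreducible_tridiagonal n A \<and> has_multiplicity_list A ms) \<and>
         (\<exists>A :: complex mat. irreducible_tridiagonal n A \<and> has_multiplicity_list A ms)"
proof -
  have "ms \<noteq> []" using assms(1,3) by auto
  then show ?thesis
    using assms(2,3) exists_tridiagonal_with_multiplicities[of ms, where 'a = real]
      exists_tridiagonal_with_multiplicities[of ms, where 'a = complex] by simp
qed

end
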